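(* Let $R$ be a Leibniz conformal algebra and $Q$ a $\mathbb{C}[\partial]$-module. Set $E=R\oplus Q$ (direct sum of $\mathbb{C}[\partial]$-modules), identified with $R\times Q$. (1) Let $\mathcal{LH}_R^2(Q,R):=\mathcal{TCL}(R,Q)/\equiv$. Then the map $\mathcal{LH}_R^2(Q,R)\to \mathrm{CExtd}(E,R)$ sending the $\equiv$-class of $\Omega(R,Q)$ to the class of $(R\natural Q,[\cdot_\lambda\cdot])$ is (well defined and) bijective. (2) Let $\mathcal{LH}^2(Q,R):=\mathcal{TCL}(R,Q)/\approx$. Then the map $\mathcal{LH}^2(Q,R)\to \mathrm{CExtd}'(E,R)$ sending the $\approx$-class of $\Omega(R,Q)$ to the class of $(R\natural Q,[\cdot_\lambda\cdot])$ is (well defined and) bijective.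
   Context: All vector spaces are over $\mathbb{C}$; $A[\lambda]$ denotes polynomials in $\lambda$ with coefficients in $A$. Maps with values in polynomials are extended coefficientwise to polynomial arguments in other indeterminates. Conformal bilinear map: for $\mathbb{C}[\partial]$-modules $U,V,W$, a $\mathbb{C}$-bilinear map $f_\lambda:U\times V\to W[\lambda]$ with $f_\lambda(\partial u,v)=-\lambda f_\lambda(u,v)$, $f_\lambda(u,\partial v)=(\partial+\lambda)f_\lambda(u,v)$. Leibniz conformal algebra: a $\mathbb{C}[\partial]$-module $R$ with a conformal bilinear map $[\cdot_\lambda\cdot]:R\times R\to R[\lambda]$ satisfying $[a_\lambda[b_\mu c]]=[[a_\lambda b]_{\lambda+\mu}c]+[b_\mu[a_\lambda c]]$. Isomorphisms are bijective $\mathbb{C}[\partial]$-module homomorphisms preserving $\lambda$-brackets. Extending datum of $R$ by $Q$: six conformal bilinear maps $\leftharpoonup_\lambda:R\times Q\to R[\lambda]$, $\rightharpoonup_\lambda:R\times Q\to Q[\lambda]$, $\lhd_\lambda:Q\times R\to Q[\lambda]$, $\rhd_\lambda:Q\times R\to R[\lambda]$, $f_\lambda:Q\times Q\to R[\lambda]$, $\{\cdot_\lambda\cdot\}:Q\times Q\to Q[\lambda]$. $R\natural Q$ is the $\mathbb{C}[\partial]$-module $R\times Q$ with $[(a,x)_\lambda(b,y)]=([a_\lambda b]+a\leftharpoonup_\lambda y+x\rhd_\lambda b+f_\lambda(x,y),\ a\rightharpoonup_\lambda y+x\lhd_\lambda b+\{x_\lambda y\})$. If this is a Leibniz conformal algebra,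 the datum is called a Leibniz conformal extending structure of $R$ by $Q$; $\mathcal{TCL}(R,Q)$ is the set of all of these. Relations on $\mathcal{TCL}(R,Q)$: $\Omega(R,Q)\equiv\Omega'(R,Q)$ if there are $\mathbb{C}[\partial]$-module homomorphisms $u:Q\to R$ and $v\in\mathrm{Aut}_{\mathbb{C}[\partial]}(Q)$ such that for all $a\in R$, $x,y\in Q$: $a\rightharpoonup_\lambda x=v^{-1}(a\rightharpoonup'_\lambda v(x))$; $a\leftharpoonup_\lambda x=[a_\lambda u(x)]+a\leftharpoonup'_\lambda v(x)-u(a\rightharpoonup_\lambda x)$; $x\lhd_\lambda a=v^{-1}(v(x)\lhd'_\lambda a)$; $x\rhd_\lambda a=[u(x)_\lambda a]+v(x)\rhd'_\lambda a-u(x\lhd_\lambda a)$; $\{x_\lambda y\}=v^{-1}(u(x)\rightharpoonup'_\lambda v(y))+v^{-1}(v(x)\lhd'_\lambda u(y))+v^{-1}(\{v(x)_\lambda v(y)\}')$; $f_\lambda(x,y)=[u(x)_\lambda u(y)]+u(x)\leftharpoonup'_\lambda v(y)+v(x)\rhd'_\lambda u(y)+f'_\lambda(v(x),v(y))-u(\{x_\lambda y\})$. $\Omega(R,Q)\approx\Omega'(R,Q)$ if this holds with $v=\mathrm{Id}_Q$ for some $u$. Relations on the set of Leibniz conformal algebra structures on $E$ containing $R$ (with its given bracket) as a subalgebra: $(E,[\cdot_\lambda\cdot])\equiv(E,[\cdot_\lambda\cdot]')$ if there is an isomorphism $\varphi:(E,[\cdot_\lambda\cdot])\to(E,[\cdot_\lambda\cdot]')$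 with $\varphi(a)=a$ for all $a\in R$ ($\varphi$ stabilizes $R$); $(E,[\cdot_\lambda\cdot])\approx(E,[\cdot_\lambda\cdot]')$ if moreover $\pi\circ\varphi=\pi$ for the projection $\pi:E\to Q$ ($\varphi$ co-stabilizes $Q$). $\mathrm{CExtd}(E,R)$ and $\mathrm{CExtd}'(E,R)$ are the sets of equivalence classes for $\equiv$ and $\approx$, respectively. *)

theory Defs
  imports "HOL-Analysis.Product_Vector" "HOL-Computational_Algebra.Polynomial"
begin

section \<open>Conformal bilinear maps\<close>

text \<open>
  A \<open>\<complex>[\<partial>]\<close>-module on a type \<open>'w\<close> is an instance of the library locale \<^locale>\<open>module\<close> whose scalars
  are complex polynomials in \<open>\<partial>\<close>; thus \<open>[:0, 1:]\<close> acts as \<open>\<partial>\<close> and \<open>[:c:]\<close> as the complex number \<open>c\<close>.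
  The space \<open>W[\<lambda>]\<close> is the type \<open>'w poly\<close>: multiplication by \<open>\<lambda>\<close> is \<open>pCons 0\<close>, and a linear map
  \<open>h\<close> is extended to coefficients by \<open>map_poly h\<close>.
\<close>

locale conformal_bilinear =
  U: module sU + V: module sV + W: module sW
  for sU :: "complex poly \<Rightarrow> 'u::ab_group_add \<Rightarrow> 'u"
    and sV :: "complex poly \<Rightarrow> 'v::ab_group_add \<Rightarrow> 'v"
    and sW :: "complex poly \<Rightarrow> 'w::ab_group_add \<Rightarrow> 'w" +
  fixes f :: "'u \<Rightarrow> 'v \<Rightarrow> 'w poly"
  assumes linear_left:
      "Vector_Spaces.linear (\<lambda>c. sU [:c:]) (\<lambda>c. map_poly (sW [:c:])) (\<lambda>u. f u v)"
    and linear_right: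
      "Vector_Spaces.linear (\<lambda>c. sV [:c:]) (\<lambda>c. map_poly (sW [:c:])) (\<lambda>v. f u v)"
    and deriv_left: "f (sU [:0, 1:] u) v = - pCons 0 (f u v)"
    and deriv_right: "f u (sV [:0, 1:] v) = map_poly (sW [:0, 1:]) (f u v) + pCons 0 (f u v)"


section \<open>Leibniz conformal algebras\<close>

text \<open>
  The space \<open>W[\<lambda>, \<mu>]\<close> is the type \<open>'w poly poly\<close>, with \<open>\<mu>\<close> the outer and \<open>\<lambda>\<close> the inner
  indeterminate.
\<close>

abbreviation mult_mu :: "'w::ab_group_add poly poly \<Rightarrow> 'w poly poly" where
  "mult_mu \<equiv> pCons 0"

abbreviation mult_lambda :: "'w::ab_group_add poly poly \<Rightarrow> 'w poly poly" where
  "mult_lambda \<equiv> map_poly (pCons 0)"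

abbreviation mult_lambda_mu :: "'w::ab_group_add poly poly \<Rightarrow> 'w poly poly" where
  "mult_lambda_mu \<equiv> (\<lambda>P. mult_lambda P + mult_mu P)"

text \<open>
  \<open>subst_poly T h p\<close> is \<open>\<Sum>n. T^n (h p\<^sub>n)\<close>: the map \<open>h\<close> is applied to the coefficients of
  \<open>p = \<Sum>n. p\<^sub>n t^n\<close>, and the indeterminate \<open>t\<close> is replaced by the quantity whose multiplication
  operator is \<open>T\<close>.
\<close>

definition subst_poly :: "('b::ab_group_add \<Rightarrow> 'b) \<Rightarrow> ('a::ab_group_add \<Rightarrow> 'b) \<Rightarrow> 'a poly \<Rightarrow> 'b" where
  "subst_poly T h p = (\<Sum>n\<le>degree p. (T ^^ n) (h (coeff p n)))"

text \<open>
  \<open>eval_at T p\<close> is the element \<open>p(t)\<close> of \<open>W[\<lambda>, \<mu>]\<close> where \<open>t\<close> is \<open>\<lambda>\<close>, \<open>\<mu>\<close> or \<open>\<lambda> + \<mu>\<close> according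
  to the operator \<open>T\<close>. In the Jacobi identity below, the three terms are
  \<open>[a\<^sub>\<lambda> [b\<^sub>\<mu> c]]\<close>, \<open>[[a\<^sub>\<lambda> b]\<^bsub>\<lambda>+\<mu>\<^esub> c]\<close> and \<open>[b\<^sub>\<mu> [a\<^sub>\<lambda> c]]\<close>; the outer \<open>subst_poly\<close> is the coefficientwise
  extension of the outer bracket to the polynomial given by the inner one.
\<close>

abbreviation eval_at :: "('w::ab_group_add poly poly \<Rightarrow> 'w poly poly) \<Rightarrow> 'w poly \<Rightarrow> 'w poly poly" where
  "eval_at T \<equiv> subst_poly T (\<lambda>r. [:[:r:]:])"

locale leibniz_conformal_algebra =
  conformal_bilinear s s s br
  for s :: "complex poly \<Rightarrow> 'r::ab_group_add \<Rightarrow> 'r"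
    and br :: "'r \<Rightarrow> 'r \<Rightarrow> 'r poly" +
  assumes jacobi:
    "subst_poly mult_mu (\<lambda>r. eval_at mult_lambda (br a r)) (br b c) =
     subst_poly mult_lambda (\<lambda>r. eval_at mult_lambda_mu (br r c)) (br a b) +
     subst_poly mult_lambda (\<lambda>r. eval_at mult_mu (br b r)) (br a c)"

definition lca_isomorphism ::
  "(complex poly \<Rightarrow> 'e::ab_group_add \<Rightarrow> 'e) \<Rightarrow> ('e \<Rightarrow> 'e \<Rightarrow> 'e poly) \<Rightarrow>
   (complex poly \<Rightarrow> 'f::ab_group_add \<Rightarrow> 'f) \<Rightarrow> ('f \<Rightarrow> 'f \<Rightarrow> 'f poly) \<Rightarrow> ('e \<Rightarrow> 'f) \<Rightarrow> bool" where
  "lca_isomorphism sE br sF br' \<phi> \<longleftrightarrow>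
     module_hom sE sF \<phi> \<and> bij \<phi> \<and> (\<forall>x y. map_poly \<phi> (br x y) = br' (\<phi> x) (\<phi> y))"


section \<open>Extending structures\<close>

text \<open>
  The fields are, in order, the maps \<open>\<leftharpoonup>\<close>, \<open>\<rightharpoonup>\<close>, \<open>\<lhd>\<close>, \<open>\<rhd>\<close>, \<open>f\<close> and \<open>{\<cdot>\<^sub>\<lambda> \<cdot>}\<close>.
\<close>

record (overloaded) ('r, 'q) ext_datum =
  lharp :: "'r \<Rightarrow> 'q \<Rightarrow> 'r poly"
  rharp :: "'r \<Rightarrow> 'q \<Rightarrow> 'q poly"
  ltri :: "'q \<Rightarrow> 'r \<Rightarrow> 'q poly"
  rtri :: "'q \<Rightarrow> 'r \<Rightarrow> 'r poly"
  cocyc :: "'q \<Rightarrow> 'q \<Rightarrow> 'r poly"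
  qbr :: "'q \<Rightarrow> 'q \<Rightarrow> 'q poly"

definition extending_datum ::
  "(complex poly \<Rightarrow> 'r::ab_group_add \<Rightarrow> 'r) \<Rightarrow> (complex poly \<Rightarrow> 'q::ab_group_add \<Rightarrow> 'q) \<Rightarrow>
   ('r, 'q) ext_datum \<Rightarrow> bool" where
  "extending_datum sR sQ \<Omega> \<longleftrightarrow>
     conformal_bilinear sR sQ sR (lharp \<Omega>) \<and>
     conformal_bilinear sR sQ sQ (rharp \<Omega>) \<and>
     conformal_bilinear sQ sR sQ (ltri \<Omega>) \<and>
     conformal_bilinear sQ sR sR (rtri \<Omega>) \<and>
     conformal_bilinear sQ sQ sR (cocyc \<Omega>) \<and>
     conformal_bilinear sQ sQ sQ (qbr \<Omega>)"

text \<open>The identification of \<open>R[\<lambda>] \<times> Q[\<lambda>]\<close> with \<open>(R \<times> Q)[\<lambda>]\<close>.\<close>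

definition pair_poly ::
  "'r::ab_group_add poly \<Rightarrow> 'q::ab_group_add poly \<Rightarrow> ('r \<times> 'q) poly" where
  "pair_poly p q = map_poly (\<lambda>a. (a, 0)) p + map_poly (\<lambda>x. (0, x)) q"

text \<open>The bracket of \<open>R \<natural> Q\<close>, where \<open>br\<close> is the bracket of \<open>R\<close>.\<close>

definition natural_bracket ::
  "('r::ab_group_add \<Rightarrow> 'r \<Rightarrow> 'r poly) \<Rightarrow> ('r, 'q::ab_group_add) ext_datum \<Rightarrow>
   'r \<times> 'q \<Rightarrow> 'r \<times> 'q \<Rightarrow> ('r \<times> 'q) poly" where
  "natural_bracket br \<Omega> = (\<lambda>(a, x) (b, y). pair_poly
     (br a b + lharp \<Omega> a y + rtri \<Omega> x b + cocyc \<Omega> x y)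
     (rharp \<Omega> a y + ltri \<Omega> x b + qbr \<Omega> x y))"

definition TCL ::
  "(complex poly \<Rightarrow> 'r::ab_group_add \<Rightarrow> 'r) \<Rightarrow> ('r \<Rightarrow> 'r \<Rightarrow> 'r poly) \<Rightarrow>
   (complex poly \<Rightarrow> 'q::ab_group_add \<Rightarrow> 'q) \<Rightarrow> ('r, 'q) ext_datum set" where
  "TCL sR br sQ = {\<Omega>. extending_datum sR sQ \<Omega> \<and>
     leibniz_conformal_algebra (module_prod.scale sR sQ) (natural_bracket br \<Omega>)}"

definition datum_transform ::
  "('r::ab_group_add \<Rightarrow> 'r \<Rightarrow> 'r poly) \<Rightarrow> ('q::ab_group_add \<Rightarrow> 'r) \<Rightarrow> ('q \<Rightarrow> 'q) \<Rightarrow>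
   ('r, 'q) ext_datum \<Rightarrow> ('r, 'q) ext_datum \<Rightarrow> bool" where
  "datum_transform br u v \<Omega> \<Omega>' \<longleftrightarrow>
     (\<forall>a x. rharp \<Omega> a x = map_poly (inv v) (rharp \<Omega>' a (v x))) \<and>
     (\<forall>a x. lharp \<Omega> a x = br a (u x) + lharp \<Omega>' a (v x) - map_poly u (rharp \<Omega> a x)) \<and>
     (\<forall>x a. ltri \<Omega> x a = map_poly (inv v) (ltri \<Omega>' (v x) a)) \<and>
     (\<forall>x a. rtri \<Omega> x a = br (u x) a + rtri \<Omega>' (v x) a - map_poly u (ltri \<Omega> x a)) \<and>
     (\<forall>x y. qbr \<Omega> x y =
        map_poly (inv v) (rharp \<Omega>' (u x) (v y)) +
        map_poly (inv v) (ltri \<Omega>' (v x) (u y)) +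
        map_poly (inv v) (qbr \<Omega>' (v x) (v y))) \<and>
     (\<forall>x y. cocyc \<Omega> x y =
        br (u x) (u y) + lharp \<Omega>' (u x) (v y) + rtri \<Omega>' (v x) (u y) +
        cocyc \<Omega>' (v x) (v y) - map_poly u (qbr \<Omega> x y))"

definition TCL_equiv ::
  "(complex poly \<Rightarrow> 'r::ab_group_add \<Rightarrow> 'r) \<Rightarrow> ('r \<Rightarrow> 'r \<Rightarrow> 'r poly) \<Rightarrow>
   (complex poly \<Rightarrow> 'q::ab_group_add \<Rightarrow> 'q) \<Rightarrow> ('r, 'q) ext_datum rel" where
  "TCL_equiv sR br sQ = {(\<Omega>, \<Omega>'). \<Omega> \<in> TCL sR br sQ \<and> \<Omega>' \<in> TCL sR br sQ \<and>
     (\<exists>u v. module_hom sQ sR u \<and> module_hom sQ sQ v \<and> bij v \<and> datum_transform br u v \<Omega> \<Omega>')}"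

definition TCL_approx ::
  "(complex poly \<Rightarrow> 'r::ab_group_add \<Rightarrow> 'r) \<Rightarrow> ('r \<Rightarrow> 'r \<Rightarrow> 'r poly) \<Rightarrow>
   (complex poly \<Rightarrow> 'q::ab_group_add \<Rightarrow> 'q) \<Rightarrow> ('r, 'q) ext_datum rel" where
  "TCL_approx sR br sQ = {(\<Omega>, \<Omega>'). \<Omega> \<in> TCL sR br sQ \<and> \<Omega>' \<in> TCL sR br sQ \<and>
     (\<exists>u. module_hom sQ sR u \<and> datum_transform br u id \<Omega> \<Omega>')}"

definition LH2_R ::
  "(complex poly \<Rightarrow> 'r::ab_group_add \<Rightarrow> 'r) \<Rightarrow> ('r \<Rightarrow> 'r \<Rightarrow> 'r poly) \<Rightarrow>
   (complex poly \<Rightarrow> 'q::ab_group_add \<Rightarrow> 'q) \<Rightarrow> ('r, 'q) ext_datum set set" where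
  "LH2_R sR br sQ = TCL sR br sQ // TCL_equiv sR br sQ"

definition LH2 ::
  "(complex poly \<Rightarrow> 'r::ab_group_add \<Rightarrow> 'r) \<Rightarrow> ('r \<Rightarrow> 'r \<Rightarrow> 'r poly) \<Rightarrow>
   (complex poly \<Rightarrow> 'q::ab_group_add \<Rightarrow> 'q) \<Rightarrow> ('r, 'q) ext_datum set set" where
  "LH2 sR br sQ = TCL sR br sQ // TCL_approx sR br sQ"


section \<open>Structures on \<open>E = R \<times> Q\<close> extending the bracket of \<open>R\<close>\<close>

type_synonym ('r, 'q) ext_bracket = "'r \<times> 'q \<Rightarrow> 'r \<times> 'q \<Rightarrow> ('r \<times> 'q) poly"

definition ext_structures ::
  "(complex poly \<Rightarrow> 'r::ab_group_add \<Rightarrow> 'r) \<Rightarrow> ('r \<Rightarrow> 'r \<Rightarrow> 'r poly) \<Rightarrow>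
   (complex poly \<Rightarrow> 'q::ab_group_add \<Rightarrow> 'q) \<Rightarrow> ('r, 'q) ext_bracket set" where
  "ext_structures sR br sQ = {brE.
     leibniz_conformal_algebra (module_prod.scale sR sQ) brE \<and>
     (\<forall>a b. brE (a, 0) (b, 0) = map_poly (\<lambda>r. (r, 0)) (br a b))}"

definition ext_equiv ::
  "(complex poly \<Rightarrow> 'r::ab_group_add \<Rightarrow> 'r) \<Rightarrow> ('r \<Rightarrow> 'r \<Rightarrow> 'r poly) \<Rightarrow>
   (complex poly \<Rightarrow> 'q::ab_group_add \<Rightarrow> 'q) \<Rightarrow> ('r, 'q) ext_bracket rel" where
  "ext_equiv sR br sQ = {(brE, brE').
     brE \<in> ext_structures sR br sQ \<and> brE' \<in> ext_structures sR br sQ \<and>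
     (\<exists>\<phi>. lca_isomorphism (module_prod.scale sR sQ) brE (module_prod.scale sR sQ) brE' \<phi> \<and>
          (\<forall>a. \<phi> (a, 0) = (a, 0)))}"

definition ext_approx ::
  "(complex poly \<Rightarrow> 'r::ab_group_add \<Rightarrow> 'r) \<Rightarrow> ('r \<Rightarrow> 'r \<Rightarrow> 'r poly) \<Rightarrow>
   (complex poly \<Rightarrow> 'q::ab_group_add \<Rightarrow> 'q) \<Rightarrow> ('r, 'q) ext_bracket rel" where
  "ext_approx sR br sQ = {(brE, brE').
     brE \<in> ext_structures sR br sQ \<and> brE' \<in> ext_structures sR br sQ \<and>
     (\<exists>\<phi>. lca_isomorphism (module_prod.scale sR sQ) brE (module_prod.scale sR sQ) brE' \<phi> \<and>
          (\<forall>a. \<phi> (a, 0) = (a, 0)) \<and> snd \<circ> \<phi> = snd)}"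

definition CExtd ::
  "(complex poly \<Rightarrow> 'r::ab_group_add \<Rightarrow> 'r) \<Rightarrow> ('r \<Rightarrow> 'r \<Rightarrow> 'r poly) \<Rightarrow>
   (complex poly \<Rightarrow> 'q::ab_group_add \<Rightarrow> 'q) \<Rightarrow> ('r, 'q) ext_bracket set set" where
  "CExtd sR br sQ = ext_structures sR br sQ // ext_equiv sR br sQ"

definition CExtd' ::
  "(complex poly \<Rightarrow> 'r::ab_group_add \<Rightarrow> 'r) \<Rightarrow> ('r \<Rightarrow> 'r \<Rightarrow> 'r poly) \<Rightarrow>
   (complex poly \<Rightarrow> 'q::ab_group_add \<Rightarrow> 'q) \<Rightarrow> ('r, 'q) ext_bracket set set" where
  "CExtd' sR br sQ = ext_structures sR br sQ // ext_approx sR br sQ"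

end

theory Submission
  imports Defs
begin

text \<open>
  A bracket on \<open>R \<times> Q\<close> that extends the bracket of \<open>R\<close> decomposes by bilinearity and the two
  projections into six conformal bilinear maps, so \<open>\<Omega> \<mapsto> R \<natural> Q\<close> is a bijection from extending
  structures onto such brackets. A \<open>\<complex>[\<partial>]\<close>-automorphism of \<open>R \<times> Q\<close> that fixes \<open>R\<close> pointwise has the form
  \<open>(a, x) \<mapsto> (a + u x, v x)\<close> with \<open>v\<close> bijective, and it co-stabilizes \<open>Q\<close> iff \<open>v = id\<close>; that it
  preserves brackets means exactly that \<open>(u, v)\<close> transforms one datum into the other. Hence the
  bijection matches the equivalence relations on both sides and descends to the quotients.
\<close>

section \<open>Quotients along a bijection\<close>

text \<open>The relation \<open>r\<close> is the pullback of \<open>s\<close> along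
  \<open>g\<close>, so it inherits the equivalence axioms, and classes correspond because
  \<open>g\<close> hits every element of \<open>B\<close>. Both parts of the theorem thereby reduce
  to showing that a relation on data is the pullback of one on brackets.\<close>

lemma quotient_bij_of_bij:
  assumes g: "bij_betw g A B" and s: "equiv B s"
    and r: "\<And>x y. (x, y) \<in> r \<longleftrightarrow> x \<in> A \<and> y \<in> A \<and> (g x, g y) \<in> s"
  shows "equiv A r"
    and "\<exists>F. (\<forall>x\<in>A. F (r `` {x}) = s `` {g x}) \<and> bij_betw F (A // r) (B // s)"
proof -
  have gB: "g x \<in> B" if "x \<in> A" for x
    using g that by (auto simp: bij_betw_def)
  have refl: "(y, y) \<in> s" if "y \<in> B" for y
    using s that by (auto simp: equiv_def refl_on_def)
  have sym: "(z, y) \<in> s" if "(y, z) \<in> s" for y z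
    using s that by (auto simp: equiv_def dest: symD)
  have trans: "(x, z) \<in> s" if "(x, y) \<in> s" "(y, z) \<in> s" for x y z
    using s that by (auto simp: equiv_def dest: transD)
  show A: "equiv A r"
  proof (rule equivI)
    show "r \<subseteq> A \<times> A" "refl_on A r" by (auto simp: refl_on_def r gB refl)
    show "sym r" by (rule symI) (auto simp: r sym)
    show "trans r" by (rule transI) (simp only: r, blast dest: trans)
  qed
  \<comment> \<open>Saturating the image of a whole class avoids choosing a representative;
    well-definedness then becomes the formula for \<open>F\<close> on the class of
    \<open>x\<close>.\<close>
  define F where "F X = s `` (g ` X)" for X
  have F: "F (r `` {x}) = s `` {g x}" if "x \<in> A" for x
  proof -
    \<comment> \<open>The image of the class contains \<open>g x\<close> and consists of elements
      \<open>s\<close>-related to it, so both have the same saturation.\<close>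
    have "g x \<in> g ` (r `` {x})" using that refl[OF gB] by (auto simp: r)
    moreover have "(g x, y) \<in> s" if "y \<in> g ` (r `` {x})" for y
      using that by (auto simp: r)
    ultimately show ?thesis unfolding F_def by (auto dest: trans)
  qed
  have "inj_on F (A // r)"
  proof (rule inj_onI)
    fix X Y assume "X \<in> A // r" "Y \<in> A // r" "F X = F Y"
    then obtain x y where xy: "x \<in> A" "y \<in> A" "X = r `` {x}" "Y = r `` {y}"
      by (auto elim!: quotientE)
    with \<open>F X = F Y\<close> have "s `` {g x} = s `` {g y}" by (simp add: F)
    with xy gB s have "(g x, g y) \<in> s" by (simp add: eq_equiv_class_iff)
    with xy have "(x, y) \<in> r" by (simp add: r)
    with xy A show "X = Y" by (simp add: equiv_class_eq)
  qed
  moreover have "F ` (A // r) = B // s"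
  proof -
    have "F ` (A // r) = (\<lambda>x. s `` {g x}) ` A"
      by (auto simp: quotient_def F image_iff)
    also have "\<dots> = (\<lambda>y. s `` {y}) ` g ` A" by (simp add: image_image)
    also have "\<dots> = B // s" using g by (auto simp: bij_betw_def quotient_def)
    finally show ?thesis .
  qed
  ultimately show "\<exists>F. (\<forall>x\<in>A. F (r `` {x}) = s `` {g x}) \<and> bij_betw F (A // r) (B // s)"
    using F unfolding bij_betw_def by blast
qed


section \<open>Coefficientwise maps\<close>

lemma map_poly_add_hom:
  assumes "module_hom s t h"
  shows "map_poly h (p + q) = map_poly h p + map_poly h q"
proof -
  interpret module_hom s t h by fact
  show ?thesis by (rule poly_eqI) (simp add: coeff_map_poly add)
qed

lemma map_poly_inv:
  assumes "module_hom s t h" "bij h"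
  shows "map_poly (inv h) (map_poly h p) = p" "map_poly h (map_poly (inv h) q) = q"
proof -
  interpret module_hom s t h by fact
  \<comment> \<open>Applying \<open>map_poly\<close> coefficient by coefficient is valid for maps
    that send 0 to 0; as a homomorphism, \<open>inv h\<close> does so.\<close>
  interpret inv: module_hom t s "inv h"
    using assms by (rule bij_module_hom_imp_inv_module_hom)
  show "map_poly (inv h) (map_poly h p) = p" "map_poly h (map_poly (inv h) q) = q"
    using assms(2)
    by (auto intro!: poly_eqI simp: coeff_map_poly bij_is_inj bij_is_surj surj_f_inv_f)
qed

lemma coeff_pair_poly: "coeff (pair_poly p q) n = (coeff p n, coeff q n)"
  by (simp add: pair_poly_def coeff_map_poly zero_prod_def)

lemma pair_poly_eq_iff: "pair_poly p q = pair_poly p' q' \<longleftrightarrow> p = p' \<and> q = q'"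
  by (auto simp: poly_eq_iff coeff_pair_poly)

lemma map_poly_fst_pair_poly [simp]: "map_poly fst (pair_poly p q) = p"
  by (simp add: poly_eq_iff coeff_map_poly coeff_pair_poly)

lemma map_poly_snd_pair_poly [simp]: "map_poly snd (pair_poly p q) = q"
  by (simp add: poly_eq_iff coeff_map_poly coeff_pair_poly)

lemma map_poly_inl: "map_poly (\<lambda>a. (a, 0)) p = pair_poly p 0"
  by (simp add: pair_poly_def)

text \<open>Restriction of scalars along the constant polynomials. The predicate
  \<open>Vector_Spaces.linear\<close> includes that source and target are vector spaces, so this has
  to be established for every new conformal bilinear map.\<close>

lemma vector_space_const_scale:
  fixes s :: "'a::field poly \<Rightarrow> 'b::ab_group_add \<Rightarrow> 'b"
  assumes "module s"
  shows "vector_space (\<lambda>c. s [:c:])"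
proof -
  interpret module s by fact
  show ?thesis
    using scale_right_distrib scale_left_distrib[of "[:_:]" "[:_:]"] scale_one
    by unfold_locales (simp_all add: one_pCons mult.commute)
qed

lemma vector_space_map_poly_const_scale:
  fixes s :: "'a::field poly \<Rightarrow> 'b::ab_group_add \<Rightarrow> 'b"
  assumes "module s"
  shows "vector_space (\<lambda>c. map_poly (s [:c:]))"
proof -
  interpret vector_space "\<lambda>c. s [:c:]" using assms by (rule vector_space_const_scale)
  show ?thesis
    by unfold_locales
      (auto intro!: poly_eqI simp: coeff_map_poly scale_right_distrib scale_left_distrib)
qed

section \<open>Additivity of conformal bilinear maps and their transport along module
  homomorphisms\<close>

context conformal_bilinear
begin

lemma add_left: "f (u + u') v = f u v + f u' v"
  using linear_left[of v] by (simp add: Vector_Spaces.linear_iff)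

lemma add_right: "f u (v + v') = f u v + f u v'"
  using linear_right[of u] by (simp add: Vector_Spaces.linear_iff)

lemma zero_left [simp]: "f 0 v = 0"
  using add_left[of 0 0 v] by simp

lemma zero_right [simp]: "f u 0 = 0"
  using add_right[of u 0 0] by simp

text \<open>The axioms involve only sums, constants, \<partial> and \<lambda>. Homomorphisms respect
  the first three, and coefficientwise application of \<open>k\<close> commutes with \<lambda>
  because \<open>k\<close> fixes 0. Applied to the inclusions and projections of
  \<open>R \<times> Q\<close>, this makes the components of a bracket conformal bilinear.\<close>

lemma compose_hom:
  assumes g: "module_hom sU' sU g" and h: "module_hom sV' sV h" and k: "module_hom sW sW' k"
  shows "conformal_bilinear sU' sV' sW' (\<lambda>u v. map_poly k (f (g u) (h v)))"
proof -
  interpret g: module_hom sU' sU g by fact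
  interpret h: module_hom sV' sV h by fact
  interpret k: module_hom sW sW' k by fact
  have km: "map_poly k (map_poly (sW c) p) = map_poly (sW' c) (map_poly k p)" for c p
    by (simp add: poly_eq_iff coeff_map_poly k.scale)
  have kp: "map_poly k (pCons 0 p) = pCons 0 (map_poly k p)" for p
    by (simp add: map_poly_pCons)
  have kmin: "map_poly k (- p) = - map_poly k p" for p
    by (simp add: poly_eq_iff coeff_map_poly k.neg)
  have l: "f (sU [:c:] u) v = map_poly (sW [:c:]) (f u v)" for c u v
    using linear_left[of v] by (simp add: Vector_Spaces.linear_iff)
  have r: "f u (sV [:c:] v) = map_poly (sW [:c:]) (f u v)" for c u v
    using linear_right[of u] by (simp add: Vector_Spaces.linear_iff)
  show ?thesis
    by (intro conformal_bilinear.intro conformal_bilinear_axioms.intro)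
      (simp_all add: Vector_Spaces.linear_iff vector_space_const_scale
        vector_space_map_poly_const_scale g.m1.module_axioms h.m1.module_axioms
        k.m2.module_axioms g.add h.add g.scale h.scale add_left add_right map_poly_add_hom[OF k]
        l r km kp kmin deriv_left deriv_right)
qed

end


section \<open>Extending structures as brackets on the product\<close>

lemma leibniz_conformal_bilinear:
  "leibniz_conformal_algebra s b \<Longrightarrow> conformal_bilinear s s s b"
  by (rule leibniz_conformal_algebra.axioms(1))

lemma natural_bracket_pair:
  "natural_bracket br \<Omega> (a, x) (b, y) = pair_poly
     (br a b + lharp \<Omega> a y + rtri \<Omega> x b + cocyc \<Omega> x y)
     (rharp \<Omega> a y + ltri \<Omega> x b + qbr \<Omega> x y)"
  by (simp add: natural_bracket_def)

lemma module_hom_prod: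
  assumes "module sR" "module sQ"
  shows "module_hom (module_prod.scale sR sQ) sR fst"
    and "module_hom (module_prod.scale sR sQ) sQ snd"
    and "module_hom sR (module_prod.scale sR sQ) (\<lambda>a. (a, 0))"
    and "module_hom sQ (module_prod.scale sR sQ) (\<lambda>x. (0, x))"
    and "module (module_prod.scale sR sQ)"
proof -
  interpret module_prod sR sQ
    using assms by (simp add: module_prod_def module_pair_def)
  show "module (module_prod.scale sR sQ)" by unfold_locales
  show "module_hom (module_prod.scale sR sQ) sR fst" by (rule module_hom_fst)
  show "module_hom (module_prod.scale sR sQ) sQ snd" by (rule module_hom_snd)
  show "module_hom sR (module_prod.scale sR sQ) (\<lambda>a. (a, 0))"
    and "module_hom sQ (module_prod.scale sR sQ) (\<lambda>x. (0, x))"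
    by (unfold_locales; simp add: scale_prod)+
qed

text \<open>The candidate inverse of \<open>natural_bracket br\<close>. The block on
  \<open>R \<times> R\<close> has no entry, since for a bracket extending that of \<open>R\<close>
  it is prescribed.\<close>

definition bracket_datum :: "('r::ab_group_add, 'q::ab_group_add) ext_bracket \<Rightarrow> ('r, 'q) ext_datum" where
  "bracket_datum b = \<lparr>
     lharp = \<lambda>a y. map_poly fst (b (a, 0) (0, y)),
     rharp = \<lambda>a y. map_poly snd (b (a, 0) (0, y)),
     ltri = \<lambda>x a. map_poly snd (b (0, x) (a, 0)),
     rtri = \<lambda>x a. map_poly fst (b (0, x) (a, 0)),
     cocyc = \<lambda>x y. map_poly fst (b (0, x) (0, y)),
     qbr = \<lambda>x y. map_poly snd (b (0, x) (0, y))\<rparr>"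

lemma extending_datumD:
  assumes "extending_datum sR sQ \<Omega>"
  shows "conformal_bilinear sR sQ sR (lharp \<Omega>)" "conformal_bilinear sR sQ sQ (rharp \<Omega>)"
    "conformal_bilinear sQ sR sQ (ltri \<Omega>)" "conformal_bilinear sQ sR sR (rtri \<Omega>)"
    "conformal_bilinear sQ sQ sR (cocyc \<Omega>)" "conformal_bilinear sQ sQ sQ (qbr \<Omega>)"
  using assms by (simp_all add: extending_datum_def)

lemma extending_datum_bracket_datum:
  assumes m: "module sR" "module sQ"
    and b: "conformal_bilinear (module_prod.scale sR sQ) (module_prod.scale sR sQ)
      (module_prod.scale sR sQ) b"
  shows "extending_datum sR sQ (bracket_datum b)"
  using module_hom_prod[OF m]
  by (simp add: extending_datum_def bracket_datum_def conformal_bilinear.compose_hom[OF b])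

text \<open>Splitting both arguments along the direct sum yields four blocks: the one on
  \<open>R\<close> is given by \<open>br\<close>, and each of the other three is recovered from its
  two projections.\<close>

lemma natural_bracket_bracket_datum:
  fixes b :: "('r::ab_group_add, 'q::ab_group_add) ext_bracket"
  assumes b: "conformal_bilinear sE sE sE b"
    and br: "\<And>r r'. b (r, 0) (r', 0) = map_poly (\<lambda>a. (a, 0)) (br r r')"
  shows "natural_bracket br (bracket_datum b) = b"
proof (intro ext)
  interpret conformal_bilinear sE sE sE b by fact
  fix e e' :: "'r \<times> 'q"
  obtain a x a' x' where e: "e = (a, x)" "e' = (a', x')" by fastforce
  have "b e e' = b ((a, 0) + (0, x)) ((a', 0) + (0, x'))"
    by (simp add: e)
  also have "\<dots> = pair_poly (br a a') 0 + b (a, 0) (0, x') + b (0, x) (a', 0) + b (0, x) (0, x')"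
    unfolding add_left add_right by (simp add: br map_poly_inl add_ac)
  finally show "natural_bracket br (bracket_datum b) e e' = b e e'"
    unfolding e natural_bracket_pair
    by (simp add: bracket_datum_def poly_eq_iff coeff_pair_poly coeff_map_poly prod_eq_iff)
qed

text \<open>On arguments taken from single summands, every term with a zero argument vanishes, and
  each coordinate retains just the component to be read off.\<close>

lemma bracket_datum_natural_bracket:
  assumes br: "conformal_bilinear sR sR sR br" and \<Omega>: "extending_datum sR sQ \<Omega>"
  shows "bracket_datum (natural_bracket br \<Omega>) = \<Omega>"
  by (simp add: bracket_datum_def natural_bracket_pair
      extending_datumD[OF \<Omega>, THEN conformal_bilinear.zero_left]
      extending_datumD[OF \<Omega>, THEN conformal_bilinear.zero_right]
      br[THEN conformal_bilinear.zero_left] br[THEN conformal_bilinear.zero_right])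

lemma natural_bracket_in_ext_structures:
  assumes \<Omega>: "\<Omega> \<in> TCL sR br sQ"
  shows "natural_bracket br \<Omega> \<in> ext_structures sR br sQ"
proof -
  have "extending_datum sR sQ \<Omega>" using \<Omega> by (simp add: TCL_def)
  note extending_datumD[OF this, THEN conformal_bilinear.zero_left]
    extending_datumD[OF this, THEN conformal_bilinear.zero_right]
  with \<Omega> show ?thesis
    by (simp add: TCL_def ext_structures_def natural_bracket_pair map_poly_inl)
qed

lemma bij_betw_natural_bracket:
  assumes R: "leibniz_conformal_algebra sR br" and Q: "module sQ"
  shows "bij_betw (natural_bracket br) (TCL sR br sQ) (ext_structures sR br sQ)"
proof (rule bij_betw_byWitness[where f' = bracket_datum])
  have br: "conformal_bilinear sR sR sR br" by (rule leibniz_conformal_bilinear[OF R])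
  then have mR: "module sR" by (simp add: conformal_bilinear_def)
  show "\<forall>\<Omega>\<in>TCL sR br sQ. bracket_datum (natural_bracket br \<Omega>) = \<Omega>"
    using bracket_datum_natural_bracket[OF br] by (auto simp: TCL_def)
  show nb: "\<forall>b\<in>ext_structures sR br sQ. natural_bracket br (bracket_datum b) = b"
    using natural_bracket_bracket_datum leibniz_conformal_bilinear
    by (fastforce simp: ext_structures_def)
  show "natural_bracket br ` TCL sR br sQ \<subseteq> ext_structures sR br sQ"
    using natural_bracket_in_ext_structures by blast
  \<comment> \<open>No Leibniz identity has to be computed: by \<open>nb\<close> the bracket rebuilt
    from the datum is the given one, which satisfies it already.\<close>
  show "bracket_datum ` ext_structures sR br sQ \<subseteq> TCL sR br sQ"
    using nb extending_datum_bracket_datum[OF mR Q] leibniz_conformal_bilinear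
    by (fastforce simp: TCL_def ext_structures_def)
qed


section \<open>Stabilizing isomorphisms\<close>

lemma lca_isomorphism_comp:
  assumes "lca_isomorphism s b s' b' \<phi>" "lca_isomorphism s' b' s'' b'' \<psi>"
  shows "lca_isomorphism s b s'' b'' (\<psi> \<circ> \<phi>)"
proof -
  have "\<phi> 0 = 0" "\<psi> 0 = 0"
    using assms module_hom.zero by (auto simp: lca_isomorphism_def)
  then have "map_poly (\<psi> \<circ> \<phi>) p = map_poly \<psi> (map_poly \<phi> p)" for p
    by (simp add: poly_eq_iff coeff_map_poly)
  moreover have "bij (\<psi> \<circ> \<phi>)" "module_hom s s'' (\<psi> \<circ> \<phi>)"
    using assms bij_comp module_hom_compose by (auto simp: lca_isomorphism_def)
  ultimately show ?thesis
    using assms by (simp add: lca_isomorphism_def)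
qed

lemma lca_isomorphism_inv:
  assumes "lca_isomorphism s b s' b' \<phi>"
  shows "lca_isomorphism s' b' s b (inv \<phi>)"
proof -
  have \<phi>: "module_hom s s' \<phi>" "bij \<phi>" "\<And>x y. b' (\<phi> x) (\<phi> y) = map_poly \<phi> (b x y)"
    using assms by (auto simp: lca_isomorphism_def)
  have "map_poly (inv \<phi>) (b' x y) = b (inv \<phi> x) (inv \<phi> y)" for x y
  proof -
    have "b' x y = map_poly \<phi> (b (inv \<phi> x) (inv \<phi> y))"
      using \<phi>(2) by (simp add: \<phi>(3)[symmetric] bij_is_surj surj_f_inv_f)
    then show ?thesis by (simp add: map_poly_inv[OF \<phi>(1,2)])
  qed
  with \<phi>(1,2) show ?thesis
    by (simp add: lca_isomorphism_def bij_module_hom_imp_inv_module_hom bij_imp_bij_inv)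
qed

text \<open>Isomorphisms subject to \<open>P\<close> contain the identity and are closed under
  composition and inverse. Keeping \<open>P\<close> abstract covers stabilizing \<open>R\<close>
  alone and co-stabilizing \<open>Q\<close> as well.\<close>

lemma equiv_lca_isomorphism:
  assumes s: "module s" and id: "P id"
    and comp: "\<And>\<phi> \<psi>. P \<phi> \<Longrightarrow> P \<psi> \<Longrightarrow> P (\<psi> \<circ> \<phi>)"
    and inv: "\<And>\<phi>. bij \<phi> \<Longrightarrow> P \<phi> \<Longrightarrow> P (inv \<phi>)"
  shows "equiv S {(b, b'). b \<in> S \<and> b' \<in> S \<and> (\<exists>\<phi>. lca_isomorphism s b s b' \<phi> \<and> P \<phi>)}"
proof (rule equivI)
  let ?r = "{(b, b'). b \<in> S \<and> b' \<in> S \<and> (\<exists>\<phi>. lca_isomorphism s b s b' \<phi> \<and> P \<phi>)}"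
  have "lca_isomorphism s b s b id" for b
    using module.module_hom_id[OF s] by (simp add: lca_isomorphism_def map_poly_idI)
  with id show "refl_on S ?r" by (auto simp: refl_on_def)
  show "sym ?r"
  proof (rule symI)
    fix b b' assume "(b, b') \<in> ?r"
    then obtain \<phi> where "b \<in> S" "b' \<in> S" and \<phi>: "lca_isomorphism s b s b' \<phi>" "P \<phi>" by auto
    moreover have "P (inv \<phi>)" using \<phi> inv by (simp add: lca_isomorphism_def)
    ultimately show "(b', b) \<in> ?r" using lca_isomorphism_inv[OF \<phi>(1)] by auto
  qed
  show "trans ?r"
  proof (rule transI)
    fix b b' b'' assume "(b, b') \<in> ?r" "(b', b'') \<in> ?r"
    then obtain \<phi> \<psi> where "b \<in> S" "b'' \<in> S" and \<phi>: "lca_isomorphism s b s b' \<phi>" "P \<phi>"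
      and \<psi>: "lca_isomorphism s b' s b'' \<psi>" "P \<psi>" by auto
    then show "(b, b'') \<in> ?r"
      using lca_isomorphism_comp[OF \<phi>(1) \<psi>(1)] comp[OF \<phi>(2) \<psi>(2)] by auto
  qed
  show "?r \<subseteq> S \<times> S" by auto
qed

lemma equiv_ext_equiv:
  assumes "module (module_prod.scale sR sQ)"
  shows "equiv (ext_structures sR br sQ) (ext_equiv sR br sQ)"
  unfolding ext_equiv_def
  by (rule equiv_lca_isomorphism[OF assms]) (auto simp: bij_is_inj inv_f_eq)

lemma equiv_ext_approx:
  assumes "module (module_prod.scale sR sQ)"
  shows "equiv (ext_structures sR br sQ) (ext_approx sR br sQ)"
  unfolding ext_approx_def
proof (rule equiv_lca_isomorphism[OF assms])
  fix \<phi> :: "'a \<times> 'b \<Rightarrow> 'a \<times> 'b"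
  assume \<phi>: "bij \<phi>" "(\<forall>a. \<phi> (a, 0) = (a, 0)) \<and> snd \<circ> \<phi> = snd"
  \<comment> \<open>Evaluate \<open>snd \<circ> \<phi> = snd\<close> at the preimage of
    \<open>e\<close>.\<close>
  have "snd (inv \<phi> e) = snd e" for e
    using \<phi> by (metis bij_is_surj comp_apply surj_f_inv_f)
  with \<phi> show "(\<forall>a. inv \<phi> (a, 0) = (a, 0)) \<and> snd \<circ> inv \<phi> = snd"
    by (auto simp: bij_is_inj inv_f_eq fun_eq_iff)
next
  fix \<phi> \<psi> :: "'a \<times> 'b \<Rightarrow> 'a \<times> 'b"
  assume "(\<forall>a. \<phi> (a, 0) = (a, 0)) \<and> snd \<circ> \<phi> = snd" "(\<forall>a. \<psi> (a, 0) = (a, 0)) \<and> snd \<circ> \<psi> = snd"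
  then show "(\<forall>a. (\<psi> \<circ> \<phi>) (a, 0) = (a, 0)) \<and> snd \<circ> (\<psi> \<circ> \<phi>) = snd"
    by (simp add: o_assoc)
qed simp

section \<open>Shears: block triangular maps of \<open>R \<times> Q\<close> with diagonal blocks the
  identity and \<open>v\<close>\<close>

definition shear :: "('q \<Rightarrow> 'r::ab_group_add) \<Rightarrow> ('q \<Rightarrow> 'q) \<Rightarrow> 'r \<times> 'q \<Rightarrow> 'r \<times> 'q" where
  "shear u v = (\<lambda>(a, x). (a + u x, v x))"

lemma shear_pair [simp]: "shear u v (a, x) = (a + u x, v x)"
  by (simp add: shear_def)

lemma module_hom_shear:
  assumes "module_hom sQ sR u" "module_hom sQ sQ v"
  shows "module_hom (module_prod.scale sR sQ) (module_prod.scale sR sQ) (shear u v)"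
proof -
  interpret u: module_hom sQ sR u by fact
  interpret v: module_hom sQ sQ v by fact
  interpret module_prod sR sQ by unfold_locales
  show ?thesis
    by unfold_locales
      (auto simp: scale_prod u.add v.add u.scale v.scale u.m2.scale_right_distrib)
qed

text \<open>The inverse comes from solving \<open>(a + u x, v x) = (b, y)\<close>: first
  \<open>x = inv v y\<close>, then \<open>a = b - u x\<close>.\<close>

lemma bij_shear: "bij v \<Longrightarrow> bij (shear u v)"
  by (rule o_bij[where g = "\<lambda>(a, x). (a - u (inv v x), inv v x)"])
    (auto simp: fun_eq_iff bij_is_inj bij_is_surj surj_f_inv_f)

text \<open>By additivity \<open>\<phi>\<close> is determined by its inclusion of \<open>R\<close>
  and its restriction to \<open>Q\<close>, whose two coordinates are \<open>u\<close> and
  \<open>v\<close>. As the diagonal block on \<open>R\<close> is the identity, bijectivity passes to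
  \<open>v\<close>.\<close>

lemma stabilizing_isomorphism_shear:
  assumes m: "module sR" "module sQ"
    and \<phi>: "module_hom (module_prod.scale sR sQ) (module_prod.scale sR sQ) \<phi>" "bij \<phi>"
      "\<And>a. \<phi> (a, 0) = (a, 0)"
  obtains u v where "module_hom sQ sR u" "module_hom sQ sQ v" "bij v" "\<phi> = shear u v"
proof -
  interpret \<phi>: module_hom "module_prod.scale sR sQ" "module_prod.scale sR sQ" \<phi> by fact
  define u where "u x = fst (\<phi> (0, x))" for x
  define v where "v x = snd (\<phi> (0, x))" for x
  note homs = module_hom_prod[OF m]
  have u: "module_hom sQ sR u"
    using module_hom_compose[OF module_hom_compose[OF homs(4) \<phi>(1)] homs(1)]
    by (simp add: o_def u_def[abs_def])
  have v: "module_hom sQ sQ v"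
    using module_hom_compose[OF module_hom_compose[OF homs(4) \<phi>(1)] homs(2)]
    by (simp add: o_def v_def[abs_def])
  have shear: "\<phi> (a, x) = (a + u x, v x)" for a x
    using \<phi>.add[of "(a, 0)" "(0, x)"] by (simp add: \<phi>(3) prod_eq_iff u_def v_def)
  have "bij v"
  proof (rule bijI)
    show "inj v"
    proof (rule injI)
      fix x y assume "v x = v y"
      \<comment> \<open>The first coordinate is chosen so that adding \<open>u y\<close> gives
        \<open>u x\<close>, the first coordinate of the left side.\<close>
      then have "\<phi> (0, x) = \<phi> (u x - u y, y)" by (simp add: shear)
      with bij_is_inj[OF \<phi>(2)] have "(0, x) = (u x - u y, y)" by (rule injD)
      then show "x = y" by simp
    qed
    show "surj v"
    proof (rule surjI)
      fix y
      have "\<phi> (inv \<phi> (0, y)) = (0, y)" using \<phi>(2) by (simp add: bij_is_surj surj_f_inv_f)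
      then show "v (snd (inv \<phi> (0, y))) = y"
        by (metis shear prod.collapse snd_conv)
    qed
  qed
  moreover have "\<phi> = shear u v" by (auto simp: shear)
  ultimately show ?thesis using that u v by blast
qed

section \<open>Bracket preservation by a shear as a transformation of data\<close>

lemma map_poly_shear:
  assumes u: "module_hom sQ sR u" and v: "module_hom sQ sQ v"
  shows "map_poly (shear u v) (pair_poly p q) = pair_poly (p + map_poly u q) (map_poly v q)"
proof -
  interpret u: module_hom sQ sR u by fact
  interpret v: module_hom sQ sQ v by fact
  have "shear u v 0 = 0" by (simp add: zero_prod_def)
  then show ?thesis by (simp add: poly_eq_iff coeff_map_poly coeff_pair_poly)
qed

text \<open>Comparing \<open>Q\<close>-coordinates gives the equations for \<open>rharp\<close>,
  \<open>ltri\<close> and \<open>qbr\<close>; comparing \<open>R\<close>-coordinates gives those for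
  \<open>lharp\<close>, \<open>rtri\<close> and \<open>cocyc\<close>. The subtracted terms
  \<open>map_poly u\<close> arise because the shear adds \<open>u\<close> of the
  \<open>Q\<close>-part of a bracket to its \<open>R\<close>-part.\<close>

lemma datum_transform_iff:
  assumes br: "conformal_bilinear sR sR sR br"
    and \<Omega>: "extending_datum sR sQ \<Omega>" and \<Omega>': "extending_datum sR sQ \<Omega>'"
    and u: "module_hom sQ sR u" and v: "module_hom sQ sQ v" "bij v"
  shows "datum_transform br u v \<Omega> \<Omega>' \<longleftrightarrow>
    (\<forall>e e'. map_poly (shear u v) (natural_bracket br \<Omega> e e') =
      natural_bracket br \<Omega>' (shear u v e) (shear u v e'))"
proof -
  interpret u: module_hom sQ sR u by fact
  interpret v: module_hom sQ sQ v by fact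
  note zeros = extending_datumD[OF \<Omega>, THEN conformal_bilinear.zero_left]
    extending_datumD[OF \<Omega>, THEN conformal_bilinear.zero_right]
    extending_datumD[OF \<Omega>', THEN conformal_bilinear.zero_left]
    extending_datumD[OF \<Omega>', THEN conformal_bilinear.zero_right]
    br[THEN conformal_bilinear.zero_left] br[THEN conformal_bilinear.zero_right]
  note adds = extending_datumD[OF \<Omega>', THEN conformal_bilinear.add_left]
    extending_datumD[OF \<Omega>', THEN conformal_bilinear.add_right]
    br[THEN conformal_bilinear.add_left] br[THEN conformal_bilinear.add_right]
    map_poly_add_hom[OF u] map_poly_add_hom[OF v(1)]
  note expand = natural_bracket_pair map_poly_shear[OF u v(1)] pair_poly_eq_iff
  \<comment> \<open>Moving \<open>v\<close> to the other side removes the inverses, so the equations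
    take the shape produced by \<open>map_poly_shear\<close>.\<close>
  have inv_v: "p = map_poly (inv v) q \<longleftrightarrow> map_poly v p = q" for p q
    using map_poly_inv[OF v] by metis
  have inv_v_add: "map_poly (inv v) (p + q) = map_poly (inv v) p + map_poly (inv v) q" for p q
    using v by (auto intro: map_poly_add_hom bij_module_hom_imp_inv_module_hom)
  \<comment> \<open>The reversed additivity rule first gathers the three inverse images in the
    \<open>qbr\<close> equation into one, to which \<open>inv_v\<close> then applies.\<close>
  note datum = datum_transform_def inv_v_add[symmetric] inv_v
  show ?thesis
  proof
    assume dt: "datum_transform br u v \<Omega> \<Omega>'"
    have Q: "map_poly v (rharp \<Omega> a x) = rharp \<Omega>' a (v x)"
      "map_poly v (ltri \<Omega> x a) = ltri \<Omega>' (v x) a"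
      "map_poly v (qbr \<Omega> x y) = rharp \<Omega>' (u x) (v y) + ltri \<Omega>' (v x) (u y) + qbr \<Omega>' (v x) (v y)"
      for a x y
      using dt unfolding datum by simp_all
    have R: "lharp \<Omega> a x = br a (u x) + lharp \<Omega>' a (v x) - map_poly u (rharp \<Omega> a x)"
      "rtri \<Omega> x a = br (u x) a + rtri \<Omega>' (v x) a - map_poly u (ltri \<Omega> x a)"
      "cocyc \<Omega> x y = br (u x) (u y) + lharp \<Omega>' (u x) (v y) + rtri \<Omega>' (v x) (u y) +
        cocyc \<Omega>' (v x) (v y) - map_poly u (qbr \<Omega> x y)"
      for a x y
      using dt unfolding datum_transform_def by metis+
    show "\<forall>e e'. map_poly (shear u v) (natural_bracket br \<Omega> e e') =
      natural_bracket br \<Omega>' (shear u v e) (shear u v e')"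
      by (simp add: split_paired_all expand adds Q R algebra_simps)
  next
    assume hom: "\<forall>e e'. map_poly (shear u v) (natural_bracket br \<Omega> e e') =
      natural_bracket br \<Omega>' (shear u v e) (shear u v e')"
    \<comment> \<open>Each of these three blocks yields two of the six equations, one per
      coordinate.\<close>
    note rq = hom[rule_format, of "(_, 0)" "(0, _)"] and qr = hom[rule_format, of "(0, _)" "(_, 0)"]
      and qq = hom[rule_format, of "(0, _)" "(0, _)"]
    show "datum_transform br u v \<Omega> \<Omega>'"
      unfolding datum
      using rq qr qq by (simp add: expand adds zeros u.zero v.zero algebra_simps)
  qed
qed

lemma lca_isomorphism_shear_iff:
  assumes R: "leibniz_conformal_algebra sR br"
    and \<Omega>: "\<Omega> \<in> TCL sR br sQ" "\<Omega>' \<in> TCL sR br sQ"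
    and u: "module_hom sQ sR u" and v: "module_hom sQ sQ v" "bij v"
  shows "lca_isomorphism (module_prod.scale sR sQ) (natural_bracket br \<Omega>)
      (module_prod.scale sR sQ) (natural_bracket br \<Omega>') (shear u v) \<longleftrightarrow>
    datum_transform br u v \<Omega> \<Omega>'"
  using module_hom_shear[OF u v(1)] bij_shear[OF v(2), of u] \<Omega>
    datum_transform_iff[OF leibniz_conformal_bilinear[OF R] _ _ u v]
  by (simp add: lca_isomorphism_def TCL_def)

section \<open>The relations on data as pullbacks of the relations on brackets\<close>

lemma shear_stabilizes:
  assumes "module_hom sQ sR u" "module_hom sQ sQ v"
  shows "shear u v (a, 0) = (a, 0)"
  using assms by (simp add: module_hom.zero)

text \<open>A pair \<open>(u, v)\<close> transforming the data gives the isomorphism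
  \<open>shear u v\<close>; conversely every isomorphism stabilizing \<open>R\<close> is such a
  shear. The form is the one \<open>quotient_bij_of_bij\<close> asks for.\<close>

lemma TCL_equiv_iff:
  assumes R: "leibniz_conformal_algebra sR br" and m: "module sR" "module sQ"
  shows "(\<Omega>, \<Omega>') \<in> TCL_equiv sR br sQ \<longleftrightarrow> \<Omega> \<in> TCL sR br sQ \<and> \<Omega>' \<in> TCL sR br sQ \<and>
    (natural_bracket br \<Omega>, natural_bracket br \<Omega>') \<in> ext_equiv sR br sQ"
    (is "?L \<longleftrightarrow> ?R")
proof
  assume ?L
  then obtain u v where *: "\<Omega> \<in> TCL sR br sQ" "\<Omega>' \<in> TCL sR br sQ" "module_hom sQ sR u"
    "module_hom sQ sQ v" "bij v" "datum_transform br u v \<Omega> \<Omega>'"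
    by (auto simp: TCL_equiv_def)
  then show ?R
    using lca_isomorphism_shear_iff[OF R *(1-5)] shear_stabilizes[OF *(3,4)]
    by (auto simp: ext_equiv_def natural_bracket_in_ext_structures)
next
  assume ?R
  then obtain \<phi> where *: "\<Omega> \<in> TCL sR br sQ" "\<Omega>' \<in> TCL sR br sQ"
    and \<phi>: "lca_isomorphism (module_prod.scale sR sQ) (natural_bracket br \<Omega>)
      (module_prod.scale sR sQ) (natural_bracket br \<Omega>') \<phi>" "\<And>a. \<phi> (a, 0) = (a, 0)"
    by (auto simp: ext_equiv_def)
  have "module_hom (module_prod.scale sR sQ) (module_prod.scale sR sQ) \<phi>" "bij \<phi>"
    using \<phi>(1) by (simp_all add: lca_isomorphism_def)
  then obtain u v where uv: "module_hom sQ sR u" "module_hom sQ sQ v" "bij v" "\<phi> = shear u v"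
    using stabilizing_isomorphism_shear[OF m _ _ \<phi>(2)] by metis
  with \<phi>(1) lca_isomorphism_shear_iff[OF R * uv(1-3)] * show ?L
    by (auto simp: TCL_equiv_def)
qed

text \<open>The same correspondence restricted to \<open>v = id\<close>, since the second coordinate
  of a shear is \<open>v\<close> and co-stabilizing \<open>Q\<close> forces it to be the
  identity.\<close>

lemma TCL_approx_iff:
  assumes R: "leibniz_conformal_algebra sR br" and m: "module sR" "module sQ"
  shows "(\<Omega>, \<Omega>') \<in> TCL_approx sR br sQ \<longleftrightarrow> \<Omega> \<in> TCL sR br sQ \<and> \<Omega>' \<in> TCL sR br sQ \<and>
    (natural_bracket br \<Omega>, natural_bracket br \<Omega>') \<in> ext_approx sR br sQ"
    (is "?L \<longleftrightarrow> ?R")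
proof -
  have id: "module_hom sQ sQ id" "bij (id :: 'b \<Rightarrow> 'b)"
    using module.module_hom_id[OF m(2)] by simp_all
  show ?thesis
  proof
    assume ?L
    then obtain u where *: "\<Omega> \<in> TCL sR br sQ" "\<Omega>' \<in> TCL sR br sQ" "module_hom sQ sR u"
      "datum_transform br u id \<Omega> \<Omega>'"
      by (auto simp: TCL_approx_def)
    moreover have "snd \<circ> shear u id = snd" by auto
    ultimately show ?R
      using lca_isomorphism_shear_iff[OF R *(1-3) id] shear_stabilizes[OF *(3) id(1)]
      by (auto simp: ext_approx_def natural_bracket_in_ext_structures)
  next
    assume ?R
    then obtain \<phi> where *: "\<Omega> \<in> TCL sR br sQ" "\<Omega>' \<in> TCL sR br sQ"
      and \<phi>: "lca_isomorphism (module_prod.scale sR sQ) (natural_bracket br \<Omega>)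
        (module_prod.scale sR sQ) (natural_bracket br \<Omega>') \<phi>" "\<And>a. \<phi> (a, 0) = (a, 0)"
        "snd \<circ> \<phi> = snd"
      by (auto simp: ext_approx_def)
    have "module_hom (module_prod.scale sR sQ) (module_prod.scale sR sQ) \<phi>" "bij \<phi>"
      using \<phi>(1) by (simp_all add: lca_isomorphism_def)
    then obtain u v where uv: "module_hom sQ sR u" "\<phi> = shear u v"
      using stabilizing_isomorphism_shear[OF m _ _ \<phi>(2)] by metis
    have "v x = x" for x
      using fun_cong[OF \<phi>(3), of "(0, x)"] by (simp add: uv(2))
    then have "v = id" by auto
    with \<phi>(1) uv(2) lca_isomorphism_shear_iff[OF R * uv(1) id] * uv(1) show ?L
      by (auto simp: TCL_approx_def)
  qed
qed

theorem theorem3p8: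
  fixes sR :: "complex poly \<Rightarrow> 'r::ab_group_add \<Rightarrow> 'r"
    and br :: "'r \<Rightarrow> 'r \<Rightarrow> 'r poly"
    and sQ :: "complex poly \<Rightarrow> 'q::ab_group_add \<Rightarrow> 'q"
  assumes R: "leibniz_conformal_algebra sR br"
    and Q: "module sQ"
  shows
    "(equiv (TCL sR br sQ) (TCL_equiv sR br sQ) \<and>
      equiv (ext_structures sR br sQ) (ext_equiv sR br sQ) \<and>
      (\<exists>F. (\<forall>\<Omega> \<in> TCL sR br sQ.
              F (TCL_equiv sR br sQ `` {\<Omega>}) = ext_equiv sR br sQ `` {natural_bracket br \<Omega>}) \<and>
           bij_betw F (LH2_R sR br sQ) (CExtd sR br sQ)))
     \<and>
     (equiv (TCL sR br sQ) (TCL_approx sR br sQ) \<and>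
      equiv (ext_structures sR br sQ) (ext_approx sR br sQ) \<and>
      (\<exists>F. (\<forall>\<Omega> \<in> TCL sR br sQ.
              F (TCL_approx sR br sQ `` {\<Omega>}) = ext_approx sR br sQ `` {natural_bracket br \<Omega>}) \<and>
           bij_betw F (LH2 sR br sQ) (CExtd' sR br sQ)))"
proof -
  have mR: "module sR"
    using leibniz_conformal_bilinear[OF R] by (simp add: conformal_bilinear_def)
  \<comment> \<open>One bijection between data and brackets serves both parts; only the pair of
    relations changes.\<close>
  note bij = bij_betw_natural_bracket[OF R Q]
  note equiv = equiv_ext_equiv[OF module_hom_prod(5)[OF mR Q], where br = br]
  note approx = equiv_ext_approx[OF module_hom_prod(5)[OF mR Q], where br = br]
  show ?thesis
    unfolding LH2_R_def LH2_def CExtd_def CExtd'_def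
    using equiv approx quotient_bij_of_bij[OF bij equiv TCL_equiv_iff[OF R mR Q]]
      quotient_bij_of_bij[OF bij approx TCL_approx_iff[OF R mR Q]]
    by (intro conjI)
qed

end
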